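(* For a distance-transitive graph $G$, we have $fix_f(G)=dim_f(G)$.
   Context: All graphs are finite, simple and undirected; $d$ denotes graph distance. A non-trivial (at least two vertices) connected graph $G$ is distance-transitive if for any two ordered pairs of vertices $(u_1,v_1)$ and $(u_2,v_2)$ with $d(u_1,v_1)=d(u_2,v_2)$ there is an automorphism $\sigma$ of $G$ with $(u_2,v_2)=(\sigma(u_1),\sigma(v_1))$. Let $\Gamma=\Gamma(G)$ be the automorphism group of $G$. For $u\in V(G)$, $O(u)$ is the $\Gamma$-orbit of $u$; for $x\in V(G)$, $\Gamma_x$ is the stabilizer of $x$ and $O_x(u)=\{\pi(u):\pi\in\Gamma_x\}$. Let $V_a(G)=\{(u,v): u\neq v,\ O(u)=O(v)\}$. For vertices $u,v$ let $F(u,v)=\{x\in V(G):O_x(u)\neq O_x(v)\}$ and $R(u,v)=\{x\in V(G): d(x,u)\neq d(x,v)\}$. For $g:V(G)\to[0,1]$ put $|g|=\sum_{x\in V(G)}g(x)$. The function $g$ is a fixing function of $G$ if $\sum_{x\in F(u,v)}g(x)\ge 1$ for every $(u,v)\in V_a(G)$; it is a resolving function of $G$ if $\sum_{x\in R(u,v)}g(x)\ge 1$ for every two distinct vertices $u,v$. The fractional fixing number $fix_f(G)$ is the minimum of $|g|$ over all fixing functions $g$; the fractional metric dimension $dim_f(G)$ is the minimum of $|g|$ over all resolving functions $g$. *)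

theory Defs
  imports "HOL-Analysis.Analysis" "Graph_Theory.Graph_Theory"
begin

text \<open>
  Finite simple undirected graphs are the \<^term>\<open>pair_graph\<close>s of the Graph Theory library: finitely
  many vertices, and a symmetric, irreflexive set of arcs given as ordered pairs of vertices.
\<close>

text \<open>Graph distance is shortest-path cost for unit arc weights; it is \<open>\<infinity>\<close> between
  different components.\<close>

definition graph_dist :: "'a pair_pre_digraph \<Rightarrow> 'a \<Rightarrow> 'a \<Rightarrow> ereal" where
  "graph_dist G u v = wf_digraph.\<mu> (with_proj G) (\<lambda>_. 1) u v"

text \<open>Automorphisms are the identity outside the vertex set, so that each one is represented by
  exactly one function.\<close>

definition Aut :: "'a pair_pre_digraph \<Rightarrow> ('a \<Rightarrow> 'a) set" where
  "Aut G = {\<pi>. \<pi> permutes pverts G \<and>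
     (\<forall>u\<in>pverts G. \<forall>v\<in>pverts G. (\<pi> u, \<pi> v) \<in> parcs G \<longleftrightarrow> (u, v) \<in> parcs G)}"

definition distance_transitive :: "'a pair_pre_digraph \<Rightarrow> bool" where
  "distance_transitive G \<longleftrightarrow>
     pair_graph G \<and> Digraph_Component.connected (with_proj G) \<and> card (pverts G) \<ge> 2 \<and>
     (\<forall>u1\<in>pverts G. \<forall>v1\<in>pverts G. \<forall>u2\<in>pverts G. \<forall>v2\<in>pverts G.
        graph_dist G u1 v1 = graph_dist G u2 v2 \<longrightarrow>
        (\<exists>\<sigma>\<in>Aut G. (u2, v2) = (\<sigma> u1, \<sigma> v1)))"

definition aut_orbit :: "'a pair_pre_digraph \<Rightarrow> 'a \<Rightarrow> 'a set" where
  "aut_orbit G u = {\<pi> u |\<pi>. \<pi> \<in> Aut G}"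

definition aut_stabilizer :: "'a pair_pre_digraph \<Rightarrow> 'a \<Rightarrow> ('a \<Rightarrow> 'a) set" where
  "aut_stabilizer G x = {\<pi> \<in> Aut G. \<pi> x = x}"

definition stabilizer_orbit :: "'a pair_pre_digraph \<Rightarrow> 'a \<Rightarrow> 'a \<Rightarrow> 'a set" where
  "stabilizer_orbit G x u = {\<pi> u |\<pi>. \<pi> \<in> aut_stabilizer G x}"

definition V_a :: "'a pair_pre_digraph \<Rightarrow> ('a \<times> 'a) set" where
  "V_a G = {(u, v). u \<in> pverts G \<and> v \<in> pverts G \<and> u \<noteq> v \<and> aut_orbit G u = aut_orbit G v}"

definition F_set :: "'a pair_pre_digraph \<Rightarrow> 'a \<Rightarrow> 'a \<Rightarrow> 'a set" where
  "F_set G u v = {x \<in> pverts G. stabilizer_orbit G x u \<noteq> stabilizer_orbit G x v}"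

definition R_set :: "'a pair_pre_digraph \<Rightarrow> 'a \<Rightarrow> 'a \<Rightarrow> 'a set" where
  "R_set G u v = {x \<in> pverts G. graph_dist G x u \<noteq> graph_dist G x v}"

text \<open>A function \<open>V(G) \<rightarrow> [0,1]\<close> is a total function whose values off the vertex set are
  irrelevant.\<close>

definition fixing_function :: "'a pair_pre_digraph \<Rightarrow> ('a \<Rightarrow> real) \<Rightarrow> bool" where
  "fixing_function G g \<longleftrightarrow> (\<forall>x\<in>pverts G. g x \<in> {0..1}) \<and>
     (\<forall>(u, v)\<in>V_a G. (\<Sum>x\<in>F_set G u v. g x) \<ge> 1)"

definition resolving_function :: "'a pair_pre_digraph \<Rightarrow> ('a \<Rightarrow> real) \<Rightarrow> bool" where
  "resolving_function G g \<longleftrightarrow> (\<forall>x\<in>pverts G. g x \<in> {0..1}) \<and>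
     (\<forall>u\<in>pverts G. \<forall>v\<in>pverts G. u \<noteq> v \<longrightarrow> (\<Sum>x\<in>R_set G u v. g x) \<ge> 1)"

definition weight :: "'a pair_pre_digraph \<Rightarrow> ('a \<Rightarrow> real) \<Rightarrow> real" where
  "weight G g = (\<Sum>x\<in>pverts G. g x)"

text \<open>These infima are minima: see \<open>fix_f_attained\<close> and \<open>dim_f_attained\<close> below.\<close>

definition fix_f :: "'a pair_pre_digraph \<Rightarrow> real" where
  "fix_f G = Inf {weight G g |g. fixing_function G g}"

definition dim_f :: "'a pair_pre_digraph \<Rightarrow> real" where
  "dim_f G = Inf {weight G g |g. resolving_function G g}"

lemma fractional_cover_minimum:
  fixes V :: "'a set" and \<S> :: "'a set set"
  assumes fin: "finite V" and S: "\<And>S. S \<in> \<S> \<Longrightarrow> S \<subseteq> V \<and> S \<noteq> {}"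
  defines "C \<equiv> {g. (\<forall>x\<in>V. g x \<in> {0..1::real}) \<and> (\<forall>S\<in>\<S>. 1 \<le> sum g S)}"
  shows "\<exists>g\<in>C. \<forall>h\<in>C. sum g V \<le> sum h V"
proof -
  define B where "B = (\<lambda>x. if x \<in> V then {0..1::real} else {0})"
  define K where "K = {g \<in> PiE UNIV B. \<forall>S\<in>\<S>. 1 \<le> sum g S}"
  have B_V: "g x \<in> {0..1}" if "g \<in> PiE UNIV B" "x \<in> V" for g x
    using PiE_mem[OF that(1), of x] that(2) by (simp add: B_def)
  have cont: "continuous_on UNIV (\<lambda>g::'a \<Rightarrow> real. sum g S)" for S
    by (intro continuous_on_sum continuous_on_product_coordinates)
  have "compact (PiE UNIV B)"
    using compactin_PiE[of "\<lambda>_. euclidean" UNIV B]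
    by (simp add: euclidean_product_topology B_def)
  moreover have "closed (\<Inter>S\<in>\<S>. {g::'a \<Rightarrow> real. 1 \<le> sum g S})"
    by (intro closed_INT ballI closed_Collect_le cont) auto
  moreover have "K = PiE UNIV B \<inter> (\<Inter>S\<in>\<S>. {g. 1 \<le> sum g S})"
    by (auto simp: K_def)
  ultimately have K: "compact K" by (simp add: compact_Int_closed)
  define e where "e = (\<lambda>h x. if x \<in> V then h x else (0::real))"
  have sum_e: "sum (e h) S = sum h S" if "S \<subseteq> V" for h S
    using that by (intro sum.cong) (auto simp: e_def)
  have eK: "e h \<in> K" if "h \<in> C" for h
    using that S sum_e[of _ h] by (auto simp: C_def K_def e_def B_def Pi_def)
  have "(\<lambda>_. 1) \<in> C"
  proof -
    have "1 \<le> card S" if "S \<in> \<S>" for S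
      using S[OF that] fin finite_subset by (metis One_nat_def Suc_leI card_gt_0_iff)
    then show ?thesis by (auto simp: C_def)
  qed
  then have "K \<noteq> {}" using eK by blast
  then obtain g where g: "g \<in> K" "\<forall>h\<in>K. sum g V \<le> sum h V"
    using continuous_attains_inf[OF K, of "\<lambda>g. sum g V"] continuous_on_subset[OF cont]
    by blast
  have "g \<in> C" using g(1) B_V by (auto simp: K_def C_def)
  moreover have "sum g V \<le> sum h V" if "h \<in> C" for h
    using g(2) eK[OF that] sum_e[of V h] by auto
  ultimately show ?thesis by blast
qed

lemma F_set_nonempty:
  assumes "u \<in> pverts G" "u \<noteq> v"
  shows "u \<in> F_set G u v"
proof -
  have "id \<in> aut_stabilizer G u" for u
    by (auto simp: aut_stabilizer_def Aut_def permutes_id)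
  then have "v \<in> stabilizer_orbit G u v"
    by (auto simp: stabilizer_orbit_def intro!: exI[of _ id])
  moreover have "stabilizer_orbit G u u \<subseteq> {u}"
    by (auto simp: stabilizer_orbit_def aut_stabilizer_def)
  ultimately show ?thesis using assms by (auto simp: F_set_def)
qed

lemma (in pair_graph) graph_dist_eq_0:
  assumes "u \<in> pverts G"
  shows "graph_dist G u v = 0 \<longleftrightarrow> u = v"
proof
  assume eq: "graph_dist G u v = 0"
  then have "u \<rightarrow>\<^sup>*\<^bsub>with_proj G\<^esub> v"
    using \<mu>_reach_conv[of "\<lambda>_. 1" u v] by (simp add: graph_dist_def)
  then obtain p where p: "\<mu> (\<lambda>_. 1) u v = awalk_cost (\<lambda>_. 1) p" "apath u p v"
    using min_cost_awalk[of u v "\<lambda>_. 1"] by auto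
  then have "p = []"
    using eq by (simp add: graph_dist_def awalk_cost_def sum_list_triv zero_ereal_def)
  then show "u = v" using p(2) by (simp add: apath_Nil_iff)
next
  assume "u = v"
  then have "graph_dist G u v \<le> 0"
    using min_cost_le_walk_cost[of u "[]" u "\<lambda>_. 1"] assms
    by (simp add: graph_dist_def awalk_Nil_iff zero_ereal_def)
  moreover have "0 \<le> graph_dist G u v"
    unfolding graph_dist_def \<mu>_def
    by (rule INF_greatest) (simp add: awalk_cost_def sum_list_triv)
  ultimately show "graph_dist G u v = 0" by simp
qed

lemma (in pair_graph) R_set_nonempty:
  assumes "u \<in> pverts G" "u \<noteq> v"
  shows "u \<in> R_set G u v"
  using assms graph_dist_eq_0[of u u] graph_dist_eq_0[of u v] by (auto simp: R_set_def)

theorem fix_f_attained: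
  assumes "finite (pverts G)"
  shows "\<exists>g. fixing_function G g \<and> weight G g = fix_f G \<and>
    (\<forall>h. fixing_function G h \<longrightarrow> weight G g \<le> weight G h)"
proof -
  let ?\<S> = "(\<lambda>(u, v). F_set G u v) ` V_a G"
  have "{g. fixing_function G g} =
      {g. (\<forall>x\<in>pverts G. g x \<in> {0..1}) \<and> (\<forall>S\<in>?\<S>. 1 \<le> sum g S)}"
    unfolding fixing_function_def by (rule Collect_cong) (simp add: case_prod_beta)
  moreover have "S \<subseteq> pverts G \<and> S \<noteq> {}" if "S \<in> ?\<S>" for S
  proof -
    from that obtain u v where "S = F_set G u v" "(u, v) \<in> V_a G" by auto
    then show ?thesis using F_set_nonempty[of u G v] by (auto simp: V_a_def F_set_def)
  qed
  ultimately have "\<exists>g\<in>{g. fixing_function G g}.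
      \<forall>h\<in>{g. fixing_function G g}. weight G g \<le> weight G h"
    using fractional_cover_minimum[of "pverts G" ?\<S>] assms unfolding weight_def by simp
  then obtain g where g: "fixing_function G g" "\<And>h. fixing_function G h \<Longrightarrow> weight G g \<le> weight G h"
    by auto
  moreover have "fix_f G = weight G g"
    unfolding fix_f_def by (rule cInf_eq_minimum) (use g in auto)
  ultimately show ?thesis by auto
qed

theorem dim_f_attained:
  assumes "pair_graph G"
  shows "\<exists>g. resolving_function G g \<and> weight G g = dim_f G \<and>
    (\<forall>h. resolving_function G h \<longrightarrow> weight G g \<le> weight G h)"
proof -
  interpret pair_graph G by fact
  let ?\<S> = "{R_set G u v |u v. u \<in> pverts G \<and> v \<in> pverts G \<and> u \<noteq> v}"
  have "{g. resolving_function G g} =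
      {g. (\<forall>x\<in>pverts G. g x \<in> {0..1}) \<and> (\<forall>S\<in>?\<S>. 1 \<le> sum g S)}"
    by (auto simp: resolving_function_def)
  moreover have "S \<subseteq> pverts G \<and> S \<noteq> {}" if "S \<in> ?\<S>" for S
    using that R_set_nonempty by (auto simp: R_set_def)
  ultimately have "\<exists>g\<in>{g. resolving_function G g}.
      \<forall>h\<in>{g. resolving_function G g}. weight G g \<le> weight G h"
    using fractional_cover_minimum[of "pverts G" ?\<S>] pair_finite_verts unfolding weight_def by simp
  then obtain g where g: "resolving_function G g"
      "\<And>h. resolving_function G h \<Longrightarrow> weight G g \<le> weight G h"
    by auto
  moreover have "dim_f G = weight G g"
    unfolding dim_f_def by (rule cInf_eq_minimum) (use g in auto)
  ultimately show ?thesis by auto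
qed

end

theory Submission
  imports Defs
begin

text \<open>
  In any graph the vertices of one orbit of \<open>\<Gamma>\<^sub>x\<close> lie on one sphere around \<open>x\<close>, because automorphisms
  preserve distance. Distance-transitivity supplies the converse: pairs \<open>(x, u)\<close> and \<open>(x, w)\<close> at
  equal distance are related by an automorphism, which then fixes \<open>x\<close>. So the orbits of \<open>\<Gamma>\<^sub>x\<close> are
  exactly the spheres around \<open>x\<close>, and hence \<open>F(u,v) = R(u,v)\<close>
  (\<open>stabilizer_orbit_eq_sphere\<close>, \<open>F_set_eq_R_set\<close>). Applied to the pairs \<open>(u, u)\<close> and \<open>(v, v)\<close> at
  distance zero, distance-transitivity also gives a single vertex orbit, so \<open>V\<^sub>a\<close> contains every pair
  of distinct vertices (\<open>V_a_eq_distinct_pairs\<close>). Fixing functions and resolving functions are then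
  cut out by the same inequalities, and the two minima range over the same set.
\<close>

lemma Aut_inv:
  assumes "\<pi> \<in> Aut G"
  shows "inv \<pi> \<in> Aut G"
proof -
  have perm: "\<pi> permutes pverts G" using assms by (simp add: Aut_def)
  have "(inv \<pi> u, inv \<pi> v) \<in> parcs G \<longleftrightarrow> (u, v) \<in> parcs G"
    if "u \<in> pverts G" "v \<in> pverts G" for u v
  proof -
    have "inv \<pi> u \<in> pverts G" "inv \<pi> v \<in> pverts G"
      using that permutes_inv[OF perm] by (simp_all add: permutes_in_image)
    then have "(\<pi> (inv \<pi> u), \<pi> (inv \<pi> v)) \<in> parcs G \<longleftrightarrow> (inv \<pi> u, inv \<pi> v) \<in> parcs G"
      using assms by (auto simp: Aut_def)
    then show ?thesis by (simp add: permutes_inverses[OF perm])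
  qed
  then show ?thesis using permutes_inv[OF perm] by (auto simp: Aut_def)
qed

lemma (in pair_graph) awalk_image_Aut:
  assumes "\<pi> \<in> Aut G" "awalk u p v"
  shows "awalk (\<pi> u) (map (map_prod \<pi> \<pi>) p) (\<pi> v)"
  using assms(2)
proof (induction p arbitrary: u)
  case Nil
  then show ?case using assms(1) by (auto simp: awalk_Nil_iff Aut_def permutes_in_image)
next
  case (Cons e p)
  then have e: "e \<in> parcs G" "u = fst e" "awalk (snd e) p v"
    by (auto simp: awalk_Cons_iff)
  then have "fst e \<in> pverts G" "snd e \<in> pverts G"
    using wellformed by auto
  then have "(\<pi> (fst e), \<pi> (snd e)) \<in> parcs G"
    using assms(1) e(1) by (auto simp: Aut_def)
  then show ?case
    using Cons.IH[OF e(3)] e(2) by (simp add: awalk_Cons_iff map_prod_def case_prod_beta)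
qed

text \<open>An automorphism maps walks to walks of the same length, so it cannot increase a distance; nor
  can its inverse.\<close>

lemma (in pair_graph) graph_dist_Aut:
  assumes "\<pi> \<in> Aut G"
  shows "graph_dist G (\<pi> u) (\<pi> v) = graph_dist G u v"
proof -
  have le: "graph_dist G (\<sigma> x) (\<sigma> y) \<le> graph_dist G x y" if "\<sigma> \<in> Aut G" for \<sigma> x y
    unfolding graph_dist_def \<mu>_def
  proof (rule INF_mono)
    fix p assume "p \<in> {p. awalk x p y}"
    then show "\<exists>q\<in>{q. awalk (\<sigma> x) q (\<sigma> y)}.
        ereal (awalk_cost (\<lambda>_. 1) q) \<le> ereal (awalk_cost (\<lambda>_. 1) p)"
      using awalk_image_Aut[OF that]
      by (intro bexI[of _ "map (map_prod \<sigma> \<sigma>) p"]) (auto simp: awalk_cost_def sum_list_triv)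
  qed
  have perm: "\<pi> permutes pverts G" using assms by (simp add: Aut_def)
  show ?thesis
    using le[OF assms, of u v] le[OF Aut_inv[OF assms], of "\<pi> u" "\<pi> v"]
    by (simp add: permutes_inverses[OF perm])
qed

lemma distance_transitiveD:
  assumes "distance_transitive G"
    and "u1 \<in> pverts G" "v1 \<in> pverts G" "u2 \<in> pverts G" "v2 \<in> pverts G"
    and "graph_dist G u1 v1 = graph_dist G u2 v2"
  obtains \<sigma> where "\<sigma> \<in> Aut G" "\<sigma> u1 = u2" "\<sigma> v1 = v2"
proof -
  have "\<exists>\<sigma>\<in>Aut G. (u2, v2) = (\<sigma> u1, \<sigma> v1)"
    using assms unfolding distance_transitive_def by blast
  then show thesis using that by auto
qed

lemma stabilizer_orbit_eq_sphere:
  assumes dt: "distance_transitive G" and x: "x \<in> pverts G" and u: "u \<in> pverts G"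
  shows "stabilizer_orbit G x u = {w \<in> pverts G. graph_dist G x w = graph_dist G x u}"
proof (intro equalityI subsetI)
  interpret pair_graph G using dt by (simp add: distance_transitive_def)
  fix w assume "w \<in> stabilizer_orbit G x u"
  then obtain \<pi> where \<pi>: "\<pi> \<in> Aut G" "\<pi> x = x" "w = \<pi> u"
    by (auto simp: stabilizer_orbit_def aut_stabilizer_def)
  then have "w \<in> pverts G" using u by (simp add: Aut_def permutes_in_image)
  then show "w \<in> {w \<in> pverts G. graph_dist G x w = graph_dist G x u}"
    using graph_dist_Aut[OF \<pi>(1), of x u] \<pi> by simp
next
  fix w assume "w \<in> {w \<in> pverts G. graph_dist G x w = graph_dist G x u}"
  then obtain \<sigma> where "\<sigma> \<in> Aut G" "\<sigma> x = x" "\<sigma> u = w"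
    using distance_transitiveD[OF dt x u x, of w] by auto
  then show "w \<in> stabilizer_orbit G x u"
    by (auto simp: stabilizer_orbit_def aut_stabilizer_def)
qed

lemma F_set_eq_R_set:
  assumes dt: "distance_transitive G" and "u \<in> pverts G" "v \<in> pverts G"
  shows "F_set G u v = R_set G u v"
proof -
  have "stabilizer_orbit G x u = stabilizer_orbit G x v \<longleftrightarrow> graph_dist G x u = graph_dist G x v"
    if "x \<in> pverts G" for x
    using assms(2,3) by (auto simp: stabilizer_orbit_eq_sphere[OF dt that])
  then show ?thesis by (auto simp: F_set_def R_set_def)
qed

lemma aut_orbit_eq_pverts:
  assumes dt: "distance_transitive G" and u: "u \<in> pverts G"
  shows "aut_orbit G u = pverts G"
proof (intro equalityI subsetI)
  fix w assume "w \<in> aut_orbit G u"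
  then show "w \<in> pverts G" using u by (auto simp: aut_orbit_def Aut_def permutes_in_image)
next
  interpret pair_graph G using dt by (simp add: distance_transitive_def)
  fix w assume w: "w \<in> pverts G"
  have "graph_dist G u u = graph_dist G w w"
    using graph_dist_eq_0[OF u, of u] graph_dist_eq_0[OF w, of w] by simp
  then obtain \<sigma> where "\<sigma> \<in> Aut G" "\<sigma> u = w"
    using distance_transitiveD[OF dt u u w w] by auto
  then show "w \<in> aut_orbit G u" by (auto simp: aut_orbit_def)
qed

lemma V_a_eq_distinct_pairs:
  assumes "distance_transitive G"
  shows "V_a G = {(u, v). u \<in> pverts G \<and> v \<in> pverts G \<and> u \<noteq> v}"
  using aut_orbit_eq_pverts[OF assms] by (auto simp: V_a_def)

lemma fixing_function_iff_resolving_function: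
  assumes "distance_transitive G"
  shows "fixing_function G g \<longleftrightarrow> resolving_function G g"
  using F_set_eq_R_set[OF assms]
  by (auto simp: fixing_function_def resolving_function_def V_a_eq_distinct_pairs[OF assms])

theorem theorem4p4:
  fixes G :: "'a pair_pre_digraph"
  assumes "distance_transitive G"
  shows "fix_f G = dim_f G"
  by (simp add: fix_f_def dim_f_def fixing_function_iff_resolving_function[OF assms])

end
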